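(* Let $M$ be a monoid, $X$ a null semigroup (i.e. there is an element $0\in X$ with $xy=0$ for all $x,y\in X$) and $\alpha$ a strong partial action of $M$ on $X$. Then $\alpha$ is globalizable (in the category of semigroups).
   Context: Let $M$ be a monoid with identity $e$. A strong partial action of $M$ on a set $X$ is a family $\alpha=\{\alpha_m:\operatorname{dom}\alpha_m\to X\}_{m\in M}$ of maps with $\operatorname{dom}\alpha_m\subseteq X$ such that: (1) $\operatorname{dom}\alpha_e=X$ and $\alpha_e=\mathrm{id}_X$; (2) $\alpha_m^{-1}(\operatorname{dom}\alpha_n)=\operatorname{dom}\alpha_{nm}\cap\operatorname{dom}\alpha_m$ for all $m,n\in M$; (3) $\alpha_n\circ\alpha_m=\alpha_{nm}$ on $\alpha_m^{-1}(\operatorname{dom}\alpha_n)$ for all $m,n\in M$. It is a global action if $\operatorname{dom}\alpha_m=X$ for all $m$. A strong partial action (global action) of $M$ on a semigroup $X$ is one on the underlying set such that each $\operatorname{dom}\alpha_m$ is a (possibly empty) subsemigroup of $X$ and each $\alpha_m$ is a semigroup homomorphism. If $\alpha$ is a strong partial action of $M$ on a semigroup $X$ and $\beta$ is a global action of $M$ on a semigroup $Y$, a morphism $\iota:\alpha\to\beta$ is a semigroup homomorphism $\iota:X\to Y$ with $\beta_m(\iota(x))=\iota(\alpha_m(x))$ for all $m\in M$, $x\in\operatorname{dom}\alpha_m$. A globalization of $\alpha$ is a pair $(\beta,\iota)$, with $\beta$ a global action of $M$ on a semigroup and $\iota:\alpha\to\beta$ a morphism, such that for all $x,y\in X$ and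 $m\in M$ with $\beta_m(\iota(x))=\iota(y)$ one has $x\in\operatorname{dom}\alpha_m$ and $\alpha_m(x)=y$. $\alpha$ is globalizable if it has a globalization. *)

theory Defs
  imports "HOL-Algebra.Group"
begin

(* Semigroups live on an explicit carrier, like the structures of HOL-Algebra. *)

record 'a magma = "'a partial_object" +
  prd :: "'a \<Rightarrow> 'a \<Rightarrow> 'a"  (infixl "\<cdot>\<index>" 70)

definition semigrp :: "('a, 'r) magma_scheme \<Rightarrow> bool" where
  "semigrp X \<longleftrightarrow>
     (\<forall>x\<in>carrier X. \<forall>y\<in>carrier X. x \<cdot>\<^bsub>X\<^esub> y \<in> carrier X) \<and>
     (\<forall>x\<in>carrier X. \<forall>y\<in>carrier X. \<forall>z\<in>carrier X.
        (x \<cdot>\<^bsub>X\<^esub> y) \<cdot>\<^bsub>X\<^esub> z = x \<cdot>\<^bsub>X\<^esub> (y \<cdot>\<^bsub>X\<^esub> z))"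

definition null_semigrp :: "('a, 'r) magma_scheme \<Rightarrow> bool" where
  "null_semigrp X \<longleftrightarrow> semigrp X \<and>
     (\<exists>z\<in>carrier X. \<forall>x\<in>carrier X. \<forall>y\<in>carrier X. x \<cdot>\<^bsub>X\<^esub> y = z)"

(* The empty set counts as a subsemigroup. *)
definition subsemigrp :: "'a set \<Rightarrow> ('a, 'r) magma_scheme \<Rightarrow> bool" where
  "subsemigrp D X \<longleftrightarrow> D \<subseteq> carrier X \<and> (\<forall>x\<in>D. \<forall>y\<in>D. x \<cdot>\<^bsub>X\<^esub> y \<in> D)"

definition semigrp_hom :: "('a, 'r) magma_scheme \<Rightarrow> ('b, 's) magma_scheme \<Rightarrow> ('a \<Rightarrow> 'b) set" where
  "semigrp_hom X Y = {h. h \<in> carrier X \<rightarrow> carrier Y \<and>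
     (\<forall>x\<in>carrier X. \<forall>y\<in>carrier X. h (x \<cdot>\<^bsub>X\<^esub> y) = h x \<cdot>\<^bsub>Y\<^esub> h y)}"

(* A partially defined map is an element of 'x \<Rightarrow> 'x option, with domain given by dom.
   The preimage of a set D under the map f is then f -` (Some ` D). *)

definition strong_partial_action ::
    "('m, 'q) monoid_scheme \<Rightarrow> 'x set \<Rightarrow> ('m \<Rightarrow> 'x \<rightharpoonup> 'x) \<Rightarrow> bool" where
  "strong_partial_action M X \<alpha> \<longleftrightarrow>
     (\<forall>m\<in>carrier M. dom (\<alpha> m) \<subseteq> X \<and> ran (\<alpha> m) \<subseteq> X) \<and>
     dom (\<alpha> \<one>\<^bsub>M\<^esub>) = X \<and> (\<forall>x\<in>X. \<alpha> \<one>\<^bsub>M\<^esub> x = Some x) \<and>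
     (\<forall>m\<in>carrier M. \<forall>n\<in>carrier M.
        \<alpha> m -` (Some ` dom (\<alpha> n)) = dom (\<alpha> (n \<otimes>\<^bsub>M\<^esub> m)) \<inter> dom (\<alpha> m)) \<and>
     (\<forall>m\<in>carrier M. \<forall>n\<in>carrier M. \<forall>x \<in> \<alpha> m -` (Some ` dom (\<alpha> n)).
        (\<alpha> n \<circ>\<^sub>m \<alpha> m) x = \<alpha> (n \<otimes>\<^bsub>M\<^esub> m) x)"

definition semigrp_strong_partial_action ::
    "('m, 'q) monoid_scheme \<Rightarrow> ('x, 'r) magma_scheme \<Rightarrow> ('m \<Rightarrow> 'x \<rightharpoonup> 'x) \<Rightarrow> bool" where
  "semigrp_strong_partial_action M X \<alpha> \<longleftrightarrow>
     semigrp X \<and> strong_partial_action M (carrier X) \<alpha> \<and>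
     (\<forall>m\<in>carrier M. subsemigrp (dom (\<alpha> m)) X \<and>
        (\<lambda>x. the (\<alpha> m x)) \<in> semigrp_hom (X\<lparr>carrier := dom (\<alpha> m)\<rparr>) X)"

definition semigrp_global_action ::
    "('m, 'q) monoid_scheme \<Rightarrow> ('x, 'r) magma_scheme \<Rightarrow> ('m \<Rightarrow> 'x \<rightharpoonup> 'x) \<Rightarrow> bool" where
  "semigrp_global_action M X \<alpha> \<longleftrightarrow>
     semigrp_strong_partial_action M X \<alpha> \<and> (\<forall>m\<in>carrier M. dom (\<alpha> m) = carrier X)"

definition action_morphism ::
    "('m, 'q) monoid_scheme \<Rightarrow> ('x, 'r) magma_scheme \<Rightarrow> ('m \<Rightarrow> 'x \<rightharpoonup> 'x) \<Rightarrow>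
     ('y, 's) magma_scheme \<Rightarrow> ('m \<Rightarrow> 'y \<rightharpoonup> 'y) \<Rightarrow> ('x \<Rightarrow> 'y) \<Rightarrow> bool" where
  "action_morphism M X \<alpha> Y \<beta> \<iota> \<longleftrightarrow>
     \<iota> \<in> semigrp_hom X Y \<and>
     (\<forall>m\<in>carrier M. \<forall>x\<in>dom (\<alpha> m). \<beta> m (\<iota> x) = Some (\<iota> (the (\<alpha> m x))))"

definition globalization ::
    "('m, 'q) monoid_scheme \<Rightarrow> ('x, 'r) magma_scheme \<Rightarrow> ('m \<Rightarrow> 'x \<rightharpoonup> 'x) \<Rightarrow>
     ('y, 's) magma_scheme \<Rightarrow> ('m \<Rightarrow> 'y \<rightharpoonup> 'y) \<Rightarrow> ('x \<Rightarrow> 'y) \<Rightarrow> bool" where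
  "globalization M X \<alpha> Y \<beta> \<iota> \<longleftrightarrow>
     semigrp_global_action M Y \<beta> \<and> action_morphism M X \<alpha> Y \<beta> \<iota> \<and>
     (\<forall>x\<in>carrier X. \<forall>y\<in>carrier X. \<forall>m\<in>carrier M.
        \<beta> m (\<iota> x) = Some (\<iota> y) \<longrightarrow> x \<in> dom (\<alpha> m) \<and> \<alpha> m x = Some y)"

(* HOL cannot quantify existentially over the type of elements of Y. The type of words over
   M \<times> X loses no generality: by globalizable_if_globalization below, a globalization with
   elements of any type yields one with elements of this type. *)
definition globalizable ::
    "('m, 'q) monoid_scheme \<Rightarrow> ('x, 'r) magma_scheme \<Rightarrow> ('m \<Rightarrow> 'x \<rightharpoonup> 'x) \<Rightarrow> bool" where
  "globalizable M X \<alpha> \<longleftrightarrow>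
     (\<exists>(Y :: ('m \<times> 'x) list magma) \<beta> \<iota>. globalization M X \<alpha> Y \<beta> \<iota>)"

lemma global_actionI:
  assumes M: "monoid M" and Y: "semigrp Y"
    and d: "\<And>m. m \<in> carrier M \<Longrightarrow> dom (\<beta> m) = carrier Y"
    and b: "\<And>m y. m \<in> carrier M \<Longrightarrow> y \<in> carrier Y \<Longrightarrow> \<beta> m y = Some (b m y)"
    and cl: "\<And>m y. m \<in> carrier M \<Longrightarrow> y \<in> carrier Y \<Longrightarrow> b m y \<in> carrier Y"
    and one: "\<And>y. y \<in> carrier Y \<Longrightarrow> b \<one>\<^bsub>M\<^esub> y = y"
    and mul: "\<And>m n y. m \<in> carrier M \<Longrightarrow> n \<in> carrier M \<Longrightarrow> y \<in> carrier Y \<Longrightarrow>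
               b n (b m y) = b (n \<otimes>\<^bsub>M\<^esub> m) y"
    and hom: "\<And>m y z. m \<in> carrier M \<Longrightarrow> y \<in> carrier Y \<Longrightarrow> z \<in> carrier Y \<Longrightarrow>
               b m (y \<cdot>\<^bsub>Y\<^esub> z) = b m y \<cdot>\<^bsub>Y\<^esub> b m z"
  shows "semigrp_global_action M Y \<beta>"
proof -
  interpret M: monoid M by (rule M)
  have ycl: "y \<cdot>\<^bsub>Y\<^esub> z \<in> carrier Y" if "y \<in> carrier Y" "z \<in> carrier Y" for y z
    using Y that by (simp add: semigrp_def)
  have inY: "y \<in> carrier Y" if "m \<in> carrier M" "\<beta> m y = Some z" for m y z
    using d[OF that(1)] that(2) by blast
  have val: "z = b m y" if "m \<in> carrier M" "\<beta> m y = Some z" for m y z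
    using b[OF that(1) inY[OF that]] that(2) by simp
  have vim: "\<beta> m -` (Some ` carrier Y) = carrier Y" if "m \<in> carrier M" for m
  proof (rule Set.set_eqI, rule iffI)
    fix y assume "y \<in> \<beta> m -` (Some ` carrier Y)"
    then obtain z where "\<beta> m y = Some z" by auto
    then show "y \<in> carrier Y" by (rule inY[OF that])
  next
    fix y assume "y \<in> carrier Y"
    then show "y \<in> \<beta> m -` (Some ` carrier Y)" using that b cl by simp
  qed
  have "strong_partial_action M (carrier Y) \<beta>"
    unfolding strong_partial_action_def
  proof (intro conjI ballI)
    fix m assume m: "m \<in> carrier M"
    show "dom (\<beta> m) \<subseteq> carrier Y" using d m by simp
    show "ran (\<beta> m) \<subseteq> carrier Y"
      unfolding ran_def using inY[OF m] val[OF m] cl[OF m] by blast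
  next
    show "dom (\<beta> \<one>\<^bsub>M\<^esub>) = carrier Y" using d by simp
  next
    fix y assume "y \<in> carrier Y" then show "\<beta> \<one>\<^bsub>M\<^esub> y = Some y" using b one by simp
  next
    fix m n assume mn: "m \<in> carrier M" "n \<in> carrier M"
    show "\<beta> m -` (Some ` dom (\<beta> n)) = dom (\<beta> (n \<otimes>\<^bsub>M\<^esub> m)) \<inter> dom (\<beta> m)"
      using mn d vim by simp
    fix y assume "y \<in> \<beta> m -` (Some ` dom (\<beta> n))"
    then have y: "y \<in> carrier Y" using mn d vim by simp
    show "(\<beta> n \<circ>\<^sub>m \<beta> m) y = \<beta> (n \<otimes>\<^bsub>M\<^esub> m) y"
      using mn y b cl mul by (simp add: map_comp_def)
  qed
  moreover have "subsemigrp (dom (\<beta> m)) Y \<and>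
      (\<lambda>x. the (\<beta> m x)) \<in> semigrp_hom (Y\<lparr>carrier := dom (\<beta> m)\<rparr>) Y" if "m \<in> carrier M" for m
    using that d b cl hom ycl by (simp add: subsemigrp_def semigrp_hom_def)
  ultimately show ?thesis
    using Y d by (simp add: semigrp_global_action_def semigrp_strong_partial_action_def)
qed

lemma global_actionD:
  assumes G: "semigrp_global_action M Y \<beta>" and M: "monoid M"
  defines "b \<equiv> \<lambda>m y. the (\<beta> m y)"
  shows "m \<in> carrier M \<Longrightarrow> y \<in> carrier Y \<Longrightarrow> \<beta> m y = Some (b m y)"
    and "m \<in> carrier M \<Longrightarrow> y \<in> carrier Y \<Longrightarrow> b m y \<in> carrier Y"
    and "y \<in> carrier Y \<Longrightarrow> b \<one>\<^bsub>M\<^esub> y = y"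
    and "m \<in> carrier M \<Longrightarrow> n \<in> carrier M \<Longrightarrow> y \<in> carrier Y \<Longrightarrow> b n (b m y) = b (n \<otimes>\<^bsub>M\<^esub> m) y"
    and "m \<in> carrier M \<Longrightarrow> y \<in> carrier Y \<Longrightarrow> z \<in> carrier Y \<Longrightarrow>
           b m (y \<cdot>\<^bsub>Y\<^esub> z) = b m y \<cdot>\<^bsub>Y\<^esub> b m z"
proof -
  have d: "dom (\<beta> m) = carrier Y" if "m \<in> carrier M" for m
    using G that by (simp add: semigrp_global_action_def)
  have S: "strong_partial_action M (carrier Y) \<beta>"
    and H: "\<And>m. m \<in> carrier M \<Longrightarrow>
      (\<lambda>x. the (\<beta> m x)) \<in> semigrp_hom (Y\<lparr>carrier := dom (\<beta> m)\<rparr>) Y"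
    using G by (auto simp: semigrp_global_action_def semigrp_strong_partial_action_def)
  show b: "\<beta> m y = Some (b m y)" if "m \<in> carrier M" "y \<in> carrier Y" for m y
  proof -
    have "y \<in> dom (\<beta> m)" using d that by simp
    then obtain z where "\<beta> m y = Some z" by auto
    then show ?thesis by (simp add: b_def)
  qed
  show cl: "b m y \<in> carrier Y" if "m \<in> carrier M" "y \<in> carrier Y" for m y
    using H[OF that(1)] d[OF that(1)] that(2) by (auto simp: semigrp_hom_def b_def)
  show "b \<one>\<^bsub>M\<^esub> y = y" if "y \<in> carrier Y" for y
    using S that by (simp add: strong_partial_action_def b_def)
  show "b n (b m y) = b (n \<otimes>\<^bsub>M\<^esub> m) y"
    if "m \<in> carrier M" "n \<in> carrier M" "y \<in> carrier Y" for m n y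
  proof -
    have "y \<in> \<beta> m -` (Some ` dom (\<beta> n))"
      using b[OF that(1,3)] cl[OF that(1,3)] d[OF that(2)] by simp
    then have "(\<beta> n \<circ>\<^sub>m \<beta> m) y = \<beta> (n \<otimes>\<^bsub>M\<^esub> m) y"
      using S that unfolding strong_partial_action_def by blast
    then have "\<beta> n (b m y) = \<beta> (n \<otimes>\<^bsub>M\<^esub> m) y"
      using b[OF that(1,3)] by (simp add: map_comp_def)
    then show ?thesis by (simp add: b_def)
  qed
  show "b m (y \<cdot>\<^bsub>Y\<^esub> z) = b m y \<cdot>\<^bsub>Y\<^esub> b m z"
    if "m \<in> carrier M" "y \<in> carrier Y" "z \<in> carrier Y" for m y z
    using H[OF that(1)] d[OF that(1)] that by (simp add: semigrp_hom_def b_def)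
qed

fun word_value :: "('y, 's) magma_scheme \<Rightarrow> ('m \<Rightarrow> 'y \<rightharpoonup> 'y) \<Rightarrow> ('x \<Rightarrow> 'y) \<Rightarrow> ('m \<times> 'x) list \<Rightarrow> 'y" where
  "word_value Y \<beta> \<iota> [] = undefined"
| "word_value Y \<beta> \<iota> [p] = the (\<beta> (fst p) (\<iota> (snd p)))"
| "word_value Y \<beta> \<iota> (p # q # w) = the (\<beta> (fst p) (\<iota> (snd p))) \<cdot>\<^bsub>Y\<^esub> word_value Y \<beta> \<iota> (q # w)"

theorem globalizable_if_globalization:
  fixes M :: "('m, 'q) monoid_scheme" and X :: "('x, 'r) magma_scheme" and Y :: "('y, 's) magma_scheme"
  assumes M: "monoid M" and A: "semigrp_strong_partial_action M X \<alpha>"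
    and G: "globalization M X \<alpha> Y \<beta> \<iota>"
  shows "globalizable M X \<alpha>"
proof -
  interpret M: monoid M by (rule M)
  have GA: "semigrp_global_action M Y \<beta>" and mor: "action_morphism M X \<alpha> Y \<beta> \<iota>"
    and univ: "\<And>x y m. x \<in> carrier X \<Longrightarrow> y \<in> carrier X \<Longrightarrow> m \<in> carrier M \<Longrightarrow>
        \<beta> m (\<iota> x) = Some (\<iota> y) \<Longrightarrow> x \<in> dom (\<alpha> m) \<and> \<alpha> m x = Some y"
    using G by (auto simp: globalization_def)
  define b where "b m y = the (\<beta> m y)" for m y
  note bD = global_actionD[OF GA M, folded b_def]
  have Y: "semigrp Y"
    using GA by (simp add: semigrp_global_action_def semigrp_strong_partial_action_def)
  have ycl: "y \<cdot>\<^bsub>Y\<^esub> z \<in> carrier Y" if "y \<in> carrier Y" "z \<in> carrier Y" for y z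
    using Y that by (simp add: semigrp_def)
  have yas: "(x \<cdot>\<^bsub>Y\<^esub> y) \<cdot>\<^bsub>Y\<^esub> z = x \<cdot>\<^bsub>Y\<^esub> (y \<cdot>\<^bsub>Y\<^esub> z)"
    if "x \<in> carrier Y" "y \<in> carrier Y" "z \<in> carrier Y" for x y z
    using Y that by (simp add: semigrp_def)
  have iY: "\<iota> x \<in> carrier Y" if "x \<in> carrier X" for x
    using mor that by (auto simp: action_morphism_def semigrp_hom_def)
  have ihom: "\<iota> (x \<cdot>\<^bsub>X\<^esub> y) = \<iota> x \<cdot>\<^bsub>Y\<^esub> \<iota> y" if "x \<in> carrier X" "y \<in> carrier X" for x y
    using mor that by (auto simp: action_morphism_def semigrp_hom_def)

  define v where "v = word_value Y \<beta> \<iota>"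
  define W :: "('m \<times> 'x) list set" where
    "W = {w. w \<noteq> [] \<and> set w \<subseteq> carrier M \<times> carrier X}"
  have v1: "v [p] = b (fst p) (\<iota> (snd p))" for p by (simp add: v_def b_def)
  have v2: "w \<noteq> [] \<Longrightarrow> v (p # w) = b (fst p) (\<iota> (snd p)) \<cdot>\<^bsub>Y\<^esub> v w" for p w
    by (cases w) (simp_all add: v_def b_def)
  have W_ind: "P w" if "w \<in> W"
    and "\<And>p. p \<in> carrier M \<times> carrier X \<Longrightarrow> P [p]"
    and "\<And>p w. p \<in> carrier M \<times> carrier X \<Longrightarrow> w \<in> W \<Longrightarrow> P w \<Longrightarrow> P (p # w)" for P w
  proof -
    have "w \<noteq> []" "set w \<subseteq> carrier M \<times> carrier X" using that(1) by (auto simp: W_def)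
    then show ?thesis
      by (induction w rule: list_nonempty_induct) (auto simp: W_def intro!: that(2,3))
  qed
  have vY: "v w \<in> carrier Y" if "w \<in> W" for w
    using that by (induction rule: W_ind[consumes 1, case_names single Cons]) (auto simp: v1 v2 W_def bD iY intro!: ycl)
  have vapp: "v (u @ w) = v u \<cdot>\<^bsub>Y\<^esub> v w" if "u \<in> W" and w: "w \<in> W" for u w
    using that(1)
  proof (induction rule: W_ind[consumes 1, case_names single Cons])
    case (single p) then show ?case using w by (simp add: v1 v2 W_def)
  next
    case (Cons p u)
    then have "b (fst p) (\<iota> (snd p)) \<in> carrier Y" by (auto intro!: bD iY)
    with Cons show ?case using w vY by (simp add: v2 W_def yas)
  qed
  have vact: "map (\<lambda>(k, x). (m \<otimes>\<^bsub>M\<^esub> k, x)) w \<in> W \<and>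
      v (map (\<lambda>(k, x). (m \<otimes>\<^bsub>M\<^esub> k, x)) w) = b m (v w)" if m: "m \<in> carrier M" and "w \<in> W" for m w
    using that(2)
  proof (induction rule: W_ind[consumes 1, case_names single Cons])
    case (single p) then show ?case using m by (auto simp: v1 W_def bD iY)
  next
    case (Cons p w)
    then have "w \<noteq> []" by (simp add: W_def)
    with Cons show ?case using m vY[OF Cons(2)] by (auto simp: v2 W_def bD iY)
  qed

  define S where "S = v ` W"
  have SY: "S \<subseteq> carrier Y" using vY by (auto simp: S_def)
  have iS: "\<iota> x \<in> S" if "x \<in> carrier X" for x
  proof -
    have "v [(\<one>\<^bsub>M\<^esub>, x)] = \<iota> x" using that by (simp add: v1 bD iY)
    moreover have "[(\<one>\<^bsub>M\<^esub>, x)] \<in> W" using that by (simp add: W_def)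
    ultimately show ?thesis unfolding S_def by (metis imageI)
  qed
  have Scl: "s \<cdot>\<^bsub>Y\<^esub> t \<in> S" if st: "s \<in> S" "t \<in> S" for s t
  proof -
    obtain u w where "u \<in> W" "w \<in> W" "s = v u" "t = v w" using st by (auto simp: S_def)
    moreover from this have "u @ w \<in> W" by (simp add: W_def)
    ultimately show ?thesis unfolding S_def using vapp by (metis imageI)
  qed
  have Sact: "b m s \<in> S" if "m \<in> carrier M" "s \<in> S" for m s
    using that vact unfolding S_def by (metis (no_types, lifting) imageE imageI)

  define c where "c = inv_into W v"
  define Z where "Z = \<lparr>carrier = c ` S, prd = (\<lambda>p q. c (v p \<cdot>\<^bsub>Y\<^esub> v q))\<rparr>"
  have vc: "v (c s) = s" if "s \<in> S" for s
    using that unfolding c_def S_def by (rule f_inv_into_f)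
  have cS: "c s \<in> carrier Z" if "s \<in> S" for s using that by (simp add: Z_def)
  have vZ: "v p \<in> S" if "p \<in> carrier Z" for p using that vc by (auto simp: Z_def)
  have cv: "c (v p) = p" if "p \<in> carrier Z" for p using that vc by (auto simp: Z_def)
  have prdZ: "p \<cdot>\<^bsub>Z\<^esub> q = c (v p \<cdot>\<^bsub>Y\<^esub> v q)" for p q by (simp add: Z_def)
  define \<gamma> where "\<gamma> m p = (if p \<in> carrier Z then Some (c (b m (v p))) else None)" for m p
  have vZY: "v p \<in> carrier Y" if "p \<in> carrier Z" for p using that vZ SY by auto
  have "semigrp Z"
    unfolding semigrp_def using vZ vZY by (auto simp: prdZ vc Scl yas intro!: cS)
  then have "semigrp_global_action M Z \<gamma>"
  proof (rule global_actionI[OF M, where b = "\<lambda>m p. c (b m (v p))"])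
    fix m assume "m \<in> carrier M"
    show "dom (\<gamma> m) = carrier Z" by (auto simp: \<gamma>_def dom_def)
  qed (use vZ vZY in \<open>auto simp: \<gamma>_def prdZ vc cv Scl Sact bD intro!: cS\<close>)
  moreover have "action_morphism M X \<alpha> Z \<gamma> (\<lambda>x. c (\<iota> x))"
    unfolding action_morphism_def
  proof (intro conjI ballI)
    show "(\<lambda>x. c (\<iota> x)) \<in> semigrp_hom X Z"
      by (auto simp: semigrp_hom_def prdZ vc iS ihom intro!: cS)
  next
    fix m x assume m: "m \<in> carrier M" and x: "x \<in> dom (\<alpha> m)"
    have *: "\<beta> m (\<iota> x) = Some (\<iota> (the (\<alpha> m x)))"
      using mor m x by (simp add: action_morphism_def)
    have "x \<in> carrier X"
      using A m x unfolding semigrp_strong_partial_action_def subsemigrp_def by blast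
    with * show "\<gamma> m (c (\<iota> x)) = Some (c (\<iota> (the (\<alpha> m x))))"
      by (simp add: \<gamma>_def cS iS vc b_def)
  qed
  moreover have "x \<in> dom (\<alpha> m) \<and> \<alpha> m x = Some y"
    if "x \<in> carrier X" "y \<in> carrier X" "m \<in> carrier M" "\<gamma> m (c (\<iota> x)) = Some (c (\<iota> y))" for x y m
  proof -
    have "c (b m (\<iota> x)) = c (\<iota> y)"
      using that by (simp add: \<gamma>_def cS iS vc)
    then have "b m (\<iota> x) = \<iota> y"
      using vc Sact iS that by metis
    then show ?thesis using univ bD(1) iY that by metis
  qed
  ultimately have "globalization M X \<alpha> Z \<gamma> (\<lambda>x. c (\<iota> x))"
    by (simp add: globalization_def)
  then show ?thesis unfolding globalizable_def by blast
qed

end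

(* Let M act on the functions on M by translation, (m F)(j) = F(j m). Then x |-> (j |-> alpha_j x)
   (undefined values included) embeds alpha into this global action of M on a set, and evaluation
   at j = e shows that the embedding reflects the action. To obtain a multiplication, record
   along with alpha_j x also alpha_j 0: set iota(x)(j) = (alpha_j x, alpha_j 0) and let the product
   of F and G be (snd F, snd F). This product is associative and commutes with translations, and
   iota(x) iota(y) = iota(0). A nonempty domain of alpha_m contains 0, as 0 = x x, and alpha_m
   then fixes 0; hence iota is equivariant. *)

theory Submission
  imports Defs
begin

text \<open>The equality is one of options: for \<open>x\<close> in the domain of
  \<open>\<alpha> m\<close>, the preimage axiom makes both sides undefined together. Undefined
  values can thus serve as ordinary values of the functions on \<open>M\<close>.\<close>

lemma strong_partial_action_mult:
  assumes "strong_partial_action M X \<alpha>" "m \<in> carrier M" "n \<in> carrier M" "\<alpha> m x = Some y"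
  shows "\<alpha> (n \<otimes>\<^bsub>M\<^esub> m) x = \<alpha> n y"
proof -
  have pre: "\<alpha> m -` (Some ` dom (\<alpha> n)) = dom (\<alpha> (n \<otimes>\<^bsub>M\<^esub> m)) \<inter> dom (\<alpha> m)"
    and comp: "\<forall>x \<in> \<alpha> m -` (Some ` dom (\<alpha> n)). (\<alpha> n \<circ>\<^sub>m \<alpha> m) x = \<alpha> (n \<otimes>\<^bsub>M\<^esub> m) x"
    using assms(1-3) unfolding strong_partial_action_def by blast+
  show ?thesis
  proof (cases "y \<in> dom (\<alpha> n)")
    case True
    then show ?thesis using comp assms(4) by (force simp: map_comp_def)
  next
    case False
    then have "x \<notin> dom (\<alpha> (n \<otimes>\<^bsub>M\<^esub> m)) \<inter> dom (\<alpha> m)"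
      unfolding pre[symmetric] using assms(4) by auto
    with False assms(4) show ?thesis by (auto simp: domIff)
  qed
qed

lemma partial_action_fixes_null_element:
  assumes A: "semigrp_strong_partial_action M X \<alpha>"
    and z: "\<And>x y. x \<in> carrier X \<Longrightarrow> y \<in> carrier X \<Longrightarrow> x \<cdot>\<^bsub>X\<^esub> y = z"
    and m: "m \<in> carrier M" and x: "x \<in> dom (\<alpha> m)"
  shows "\<alpha> m z = Some z"
proof -
  have sub: "subsemigrp (dom (\<alpha> m)) X"
    and hom: "(\<lambda>x. the (\<alpha> m x)) \<in> semigrp_hom (X\<lparr>carrier := dom (\<alpha> m)\<rparr>) X"
    using A m by (auto simp: semigrp_strong_partial_action_def)
  have xx: "x \<cdot>\<^bsub>X\<^esub> x = z" using sub x z by (auto simp: subsemigrp_def)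
  then have "z \<in> dom (\<alpha> m)" using sub x unfolding subsemigrp_def by metis
  moreover have "the (\<alpha> m x) \<in> carrier X"
    and "the (\<alpha> m (x \<cdot>\<^bsub>X\<^esub> x)) = the (\<alpha> m x) \<cdot>\<^bsub>X\<^esub> the (\<alpha> m x)"
    using hom x by (auto simp: semigrp_hom_def)
  ultimately show ?thesis using z xx by auto
qed

text \<open>Extensional functions are determined by their values on \<open>M\<close>, so translation
  by the identity is the identity map. Both bracketings of a triple product depend only on
  \<open>snd\<close> of the first factor.\<close>

definition translation_semigrp :: "('m, 'q) monoid_scheme \<Rightarrow> ('m \<Rightarrow> 'a \<times> 'a) magma" where
  "translation_semigrp M =
     \<lparr>carrier = extensional (carrier M), prd = \<lambda>F G. \<lambda>j\<in>carrier M. (snd (F j), snd (F j))\<rparr>"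

text \<open>Multiplying the argument on the right gives a left action: translating by
  \<open>m\<close>, then by \<open>n\<close>, evaluates \<open>F\<close> at
  \<open>j n m\<close>.\<close>

definition translate :: "('m, 'q) monoid_scheme \<Rightarrow> 'm \<Rightarrow> ('m \<Rightarrow> 'a) \<Rightarrow> 'm \<Rightarrow> 'a" where
  "translate M m F = (\<lambda>j\<in>carrier M. F (j \<otimes>\<^bsub>M\<^esub> m))"

definition translation_action :: "('m, 'q) monoid_scheme \<Rightarrow> 'm \<Rightarrow> ('m \<Rightarrow> 'a) \<rightharpoonup> ('m \<Rightarrow> 'a)" where
  "translation_action M m F = (if F \<in> extensional (carrier M) then Some (translate M m F) else None)"

lemma semigrp_global_action_translation:
  assumes M: "monoid M"
  shows "semigrp_global_action M (translation_semigrp M) (translation_action M)"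
proof -
  interpret M: monoid M by (rule M)
  have "semigrp (translation_semigrp M)"
    by (auto simp: semigrp_def translation_semigrp_def)
  then show ?thesis
  proof (rule global_actionI[OF M, where b = "translate M"])
    fix F :: "'a \<Rightarrow> 'c \<times> 'c" assume "F \<in> carrier (translation_semigrp M)"
    then show "translate M \<one>\<^bsub>M\<^esub> F = F"
      by (auto simp: translation_semigrp_def translate_def intro: extensionalityI[of _ "carrier M"])
  qed (auto simp: translation_semigrp_def translation_action_def translate_def M.m_assoc
         intro!: restrict_ext split: if_splits)
qed

theorem corollary4p22:
  fixes M :: "('m, 'q) monoid_scheme"
    and X :: "('x, 'r) magma_scheme"
    and \<alpha> :: "'m \<Rightarrow> 'x \<rightharpoonup> 'x"
  assumes "monoid M"
    and "null_semigrp X"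
    and "semigrp_strong_partial_action M X \<alpha>"
  shows "globalizable M X \<alpha>"
proof -
  interpret M: monoid M by (rule assms(1))
  obtain z where zX: "z \<in> carrier X"
    and z: "\<And>x y. x \<in> carrier X \<Longrightarrow> y \<in> carrier X \<Longrightarrow> x \<cdot>\<^bsub>X\<^esub> y = z"
    using assms(2) by (auto simp: null_semigrp_def)
  have S: "strong_partial_action M (carrier X) \<alpha>"
    using assms(3) by (simp add: semigrp_strong_partial_action_def)
  then have one: "\<alpha> \<one>\<^bsub>M\<^esub> x = Some x" if "x \<in> carrier X" for x
    using that by (simp add: strong_partial_action_def)
  define \<iota> where "\<iota> x = (\<lambda>j\<in>carrier M. (\<alpha> j x, \<alpha> j z))" for x
  have "\<iota> \<in> semigrp_hom X (translation_semigrp M)"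
    using zX by (auto simp: semigrp_hom_def translation_semigrp_def \<iota>_def z intro!: restrict_ext)
  moreover have "translation_action M m (\<iota> x) = Some (\<iota> (the (\<alpha> m x)))"
    if m: "m \<in> carrier M" and x: "x \<in> dom (\<alpha> m)" for m x
  proof -
    from x obtain y where "\<alpha> m x = Some y" by auto
    moreover have "\<alpha> m z = Some z"
      using partial_action_fixes_null_element[OF assms(3) z m x] .
    \<comment> \<open>The product rule applies to both components: \<alpha> at \<open>j m\<close>
      sends \<open>x\<close> to \<open>\<alpha> j y\<close> and \<open>z\<close> to
      \<open>\<alpha> j z\<close>.\<close>
    ultimately show ?thesis
      using strong_partial_action_mult[OF S m] m
      by (auto simp: translation_action_def translate_def \<iota>_def intro!: restrict_ext)
  qed
  moreover have "\<alpha> m x = Some y"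
    if y: "y \<in> carrier X" and m: "m \<in> carrier M"
      and eq: "translation_action M m (\<iota> x) = Some (\<iota> y)" for x y m
  proof -
    \<comment> \<open>The first components here are \<open>\<alpha> m x\<close> and
      \<open>Some y\<close>, so definedness of \<open>\<alpha> m x\<close> follows as well.\<close>
    have "translate M m (\<iota> x) \<one>\<^bsub>M\<^esub> = \<iota> y \<one>\<^bsub>M\<^esub>"
      using eq by (simp add: translation_action_def split: if_splits)
    then show ?thesis using m one[OF y] by (simp add: translate_def \<iota>_def)
  qed
  ultimately have "globalization M X \<alpha> (translation_semigrp M) (translation_action M) \<iota>"
    using semigrp_global_action_translation[OF assms(1)]
    by (auto simp: globalization_def action_morphism_def)
  \<comment> \<open>The elements found are functions on \<open>M\<close>; it remains to pass to the
    type of words.\<close>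
  then show ?thesis
    by (rule globalizable_if_globalization[OF assms(1,3)])
qed

end
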